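(* Let $f_1,f_2:\mathbb{R}^n\to(-\infty,\infty]$ be proper closed convex functions such that $f_1$ is $\sigma_1$-convex and $f_2$ is $\sigma_2$-convex, with $\sigma_1,\sigma_2\ge 0$ and $\sigma_1+\sigma_2>0$. Assume that there is a closed set $Y\subseteq\mathbb{R}^n$ with $\mathrm{dom}(f_1)\subseteq Y\subseteq \mathrm{int}(\mathrm{dom}(f_2))$, and that $f:=f_1-f_2$ is bounded below, i.e. there is a scalar $f^*\in\mathbb{R}$ with $f(x)\ge f^*$ for all $x\in\mathbb{R}^n$. Let $\gamma\in[0,(\sigma_1+\sigma_2)/2)$, let $\{x^k\}$ be a sequence generated by the exact refined inertial DC algorithm RInDCA$_{\mathrm e}$ with inertial step-size $\gamma$, and let $y^k\in\partial f_2(x^k)$ ($k\ge0$) be the subgradients used in the algorithm. Define $$E(x,y,z)=f_1(x)-\langle x,y\rangle+f_2^*(y)+\frac{\sigma_1-\gamma}{2}\|x-z\|^2,\qquad (x,y,z)\in\mathbb{R}^n\times\mathbb{R}^n\times\mathbb{R}^n,$$ and suppose that $E$ is a KL function. Then: (i) there exists $D>0$ such that for all $k\ge1$, $$\mathrm{dist}\big(0,\partial E(x^k,y^{k-1},x^{k-1})\big)\le D\big(\|x^k-x^{k-1}\|+\|x^{k-1}-x^{k-2}\|\big);$$ (ii) if $\{x^k\}$ is bounded, then $\{x^k\}$ converges to a critical point of the problem $\min\{f_1(x)-f_2(x):x\in\mathbb{R}^n\}$.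
   Context: $\mathrm{dom}(h)=\{x: h(x)<\infty\}$; $\|\cdot\|$ is the Euclidean norm; $f_2^*(y)=\sup_x\{\langle y,x\rangle-f_2(x)\}$ is the conjugate function; $\mathrm{dist}(x,C)=\inf\{\|x-z\|:z\in C\}$. The function $f=f_1-f_2$ takes the value $+\infty$ outside $\mathrm{dom}(f_1)$. A function is closed if its epigraph is closed. Subdifferentials: for a proper closed function $h$ and $x\in\mathrm{dom}(h)$, the Fréchet subdifferential is $\partial^Fh(x)=\{y:\liminf_{z\to x}\frac{h(z)-h(x)-\langle y,z-x\rangle}{\|z-x\|}\ge0\}$, and the (limiting) subdifferential is $\partial h(x)=\{y:\exists\, x^j\to x,\ h(x^j)\to h(x),\ y^j\in\partial^Fh(x^j),\ y^j\to y\}$; both are empty for $x\notin\mathrm{dom}(h)$. For convex $h$, $\partial h$ is the usual convex subdifferential. $\mathrm{dom}(\partial h)=\{x:\partial h(x)\ne\emptyset\}$. A proper closed function $h$ is $\sigma$-convex ($\sigma\ge0$) if for all $x,z\in\mathrm{dom}(h)$ and $\lambda\in[0,1]$: $h(\lambda x+(1-\lambda)z)\le\lambda h(x)+(1-\lambda)h(z)-\frac{\sigma}{2}\lambda(1-\lambda)\|x-z\|^2$. KL function: for $\eta\in(0,\infty]$ let $\Xi_\eta$ be the set of all concave continuous functions $\varphi:[0,\eta)\to[0,\infty)$ that are continuously differentiable on $(0,\eta)$ with positive derivative and satisfy $\varphi(0)=0$. A proper closed function $h$ satisfies the KL property at $\bar x\in\mathrm{dom}(\partial h)$ if there exist $\eta\in(0,\infty]$,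 a neighborhood $U$ of $\bar x$ and $\varphi\in\Xi_\eta$ such that $\varphi'(h(x)-h(\bar x))\,\mathrm{dist}(0,\partial h(x))\ge1$ for all $x\in U$ with $h(\bar x)<h(x)<h(\bar x)+\eta$. $h$ is a KL function if it satisfies the KL property at every point of $\mathrm{dom}(\partial h)$. RInDCA$_{\mathrm e}$ (with step-size $\gamma$): start from $x^0\in\mathrm{dom}(f_1)$ and $x^{-1}=x^0$. For $k=0,1,2,\dots$, choose $y^k\in\partial f_2(x^k)$ and $x^{k+1}\in\operatorname{argmin}\{f_1(x)-\langle y^k+\gamma(x^k-x^{k-1}),x\rangle: x\in\mathbb{R}^n\}$ (equivalently $y^k+\gamma(x^k-x^{k-1})\in\partial f_1(x^{k+1})$). "A sequence generated by the algorithm" is any infinite sequence satisfying these relations. A point $\bar x$ is a critical point of the problem if $\partial f_1(\bar x)\cap\partial f_2(\bar x)\neq\emptyset$. *)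

theory Defs
  imports "HOL-Analysis.Analysis"
begin

section \<open>Extended-real-valued functions\<close>

definition edom :: "('a \<Rightarrow> ereal) \<Rightarrow> 'a set" where
  "edom h = {x. h x < \<infinity>}"

definition epigraph_ereal :: "('a \<Rightarrow> ereal) \<Rightarrow> ('a \<times> real) set" where
  "epigraph_ereal h = {(x, r). h x \<le> ereal r}"

definition proper_fun :: "('a \<Rightarrow> ereal) \<Rightarrow> bool" where
  "proper_fun h \<longleftrightarrow> (\<forall>x. h x \<noteq> -\<infinity>) \<and> edom h \<noteq> {}"

definition closed_fun :: "('a::topological_space \<Rightarrow> ereal) \<Rightarrow> bool" where
  "closed_fun h \<longleftrightarrow> closed (epigraph_ereal h)"

definition convex_fun :: "('a::real_vector \<Rightarrow> ereal) \<Rightarrow> bool" where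
  "convex_fun h \<longleftrightarrow> convex (epigraph_ereal h)"

definition sigma_convex :: "real \<Rightarrow> ('a::real_normed_vector \<Rightarrow> ereal) \<Rightarrow> bool" where
  "sigma_convex \<sigma> h \<longleftrightarrow>
     (\<forall>x\<in>edom h. \<forall>z\<in>edom h. \<forall>l\<in>{0..1}.
        h (l *\<^sub>R x + (1 - l) *\<^sub>R z)
          \<le> ereal l * h x + ereal (1 - l) * h z
             - ereal (\<sigma> / 2 * l * (1 - l) * (norm (x - z))\<^sup>2))"

definition conjugate_fun :: "('a::real_inner \<Rightarrow> ereal) \<Rightarrow> 'a \<Rightarrow> ereal" where
  "conjugate_fun h y = (SUP x. ereal (y \<bullet> x) - h x)"

text \<open>Distance to a set with value \<open>\<infinity>\<close> for the empty set; the library's \<open>infdist\<close>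
  would give 0 there.\<close>

definition edist_set :: "'a::real_normed_vector \<Rightarrow> 'a set \<Rightarrow> ereal" where
  "edist_set x C = (INF z\<in>C. ereal (norm (x - z)))"


section \<open>Subdifferentials\<close>

definition frechet_subdiff :: "('a::euclidean_space \<Rightarrow> ereal) \<Rightarrow> 'a \<Rightarrow> 'a set" where
  "frechet_subdiff h x =
     {y. x \<in> edom h \<and>
         0 \<le> Liminf (at x) (\<lambda>z. (h z - h x - ereal (y \<bullet> (z - x))) / ereal (norm (z - x)))}"

definition subdiff :: "('a::euclidean_space \<Rightarrow> ereal) \<Rightarrow> 'a \<Rightarrow> 'a set" where
  "subdiff h x =
     {y. x \<in> edom h \<and>
         (\<exists>X Y. X \<longlonglongrightarrow> x \<and> (\<lambda>j. h (X j)) \<longlonglongrightarrow> h x \<and>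
                (\<forall>j::nat. Y j \<in> frechet_subdiff h (X j)) \<and> Y \<longlonglongrightarrow> y)}"

definition dom_subdiff :: "('a::euclidean_space \<Rightarrow> ereal) \<Rightarrow> 'a set" where
  "dom_subdiff h = {x. subdiff h x \<noteq> {}}"


section \<open>Kurdyka--Lojasiewicz functions\<close>

definition desingularizing :: "ereal \<Rightarrow> (real \<Rightarrow> real) set" where
  "desingularizing \<eta> =
     {\<phi>. concave_on {t. 0 \<le> t \<and> ereal t < \<eta>} \<phi> \<and>
          continuous_on {t. 0 \<le> t \<and> ereal t < \<eta>} \<phi> \<and>
          (\<forall>t. 0 \<le> t \<and> ereal t < \<eta> \<longrightarrow> 0 \<le> \<phi> t) \<and>
          (\<forall>t. 0 < t \<and> ereal t < \<eta> \<longrightarrow> \<phi> differentiable (at t)) \<and>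
          continuous_on {t. 0 < t \<and> ereal t < \<eta>} (deriv \<phi>) \<and>
          (\<forall>t. 0 < t \<and> ereal t < \<eta> \<longrightarrow> 0 < deriv \<phi> t) \<and>
          \<phi> 0 = 0}"

definition KL_property_at :: "('a::euclidean_space \<Rightarrow> ereal) \<Rightarrow> 'a \<Rightarrow> bool" where
  "KL_property_at h xbar \<longleftrightarrow>
     (\<exists>\<eta>>0. \<exists>U. \<exists>\<phi>\<in>desingularizing \<eta>. open U \<and> xbar \<in> U \<and>
        (\<forall>x\<in>U. h xbar < h x \<and> h x < h xbar + \<eta> \<longrightarrow>
           1 \<le> ereal (deriv \<phi> (real_of_ereal (h x - h xbar))) * edist_set 0 (subdiff h x)))"

definition KL_function :: "('a::euclidean_space \<Rightarrow> ereal) \<Rightarrow> bool" where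
  "KL_function h \<longleftrightarrow> (\<forall>xbar\<in>dom_subdiff h. KL_property_at h xbar)"


section \<open>The DC problem and the inertial algorithm\<close>

definition dc_fun :: "('a \<Rightarrow> ereal) \<Rightarrow> ('a \<Rightarrow> ereal) \<Rightarrow> 'a \<Rightarrow> ereal" where
  "dc_fun f1 f2 x = (if x \<in> edom f1 then f1 x - f2 x else \<infinity>)"

definition critical_point ::
  "('a::euclidean_space \<Rightarrow> ereal) \<Rightarrow> ('a \<Rightarrow> ereal) \<Rightarrow> 'a \<Rightarrow> bool" where
  "critical_point f1 f2 x \<longleftrightarrow> subdiff f1 x \<inter> subdiff f2 x \<noteq> {}"

text \<open>The iterate $x^{k-1}$, for $k \ge 0$, with the convention $x^{-1} = x^0$.\<close>

definition prev :: "(nat \<Rightarrow> 'a) \<Rightarrow> nat \<Rightarrow> 'a" where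
  "prev x k = (case k of 0 \<Rightarrow> x 0 | Suc j \<Rightarrow> x j)"

definition RInDCA_e ::
  "('a::euclidean_space \<Rightarrow> ereal) \<Rightarrow> ('a \<Rightarrow> ereal) \<Rightarrow> real \<Rightarrow>
   (nat \<Rightarrow> 'a) \<Rightarrow> (nat \<Rightarrow> 'a) \<Rightarrow> bool" where
  "RInDCA_e f1 f2 \<gamma> x y \<longleftrightarrow>
     x 0 \<in> edom f1 \<and>
     (\<forall>k. y k \<in> subdiff f2 (x k) \<and>
          is_arg_min (\<lambda>u. f1 u - ereal ((y k + \<gamma> *\<^sub>R (x k - prev x k)) \<bullet> u)) (\<lambda>_. True)
            (x (Suc k)))"

definition aux_fun ::
  "('a::euclidean_space \<Rightarrow> ereal) \<Rightarrow> ('a \<Rightarrow> ereal) \<Rightarrow> real \<Rightarrow> real \<Rightarrow>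
   'a \<times> 'a \<times> 'a \<Rightarrow> ereal" where
  "aux_fun f1 f2 \<sigma>1 \<gamma> = (\<lambda>(x, y, z).
     f1 x - ereal (x \<bullet> y) + conjugate_fun f2 y + ereal ((\<sigma>1 - \<gamma>) / 2 * (norm (x - z))\<^sup>2))"

end

theory Submission
  imports Defs
begin

text \<open>The merit values \<open>e k = E(x (k+1), y k, x k)\<close> decrease by at least a multiple of
  \<open>(norm (x (k+1) - x k))\<^sup>2\<close> because the strong convexity of both functions outweighs the inertial
  term, and explicit subgradients of \<open>E\<close> at these points are controlled by two consecutive
  steps. If the iterates are bounded, so are the subgradients of \<open>f2\<close>, since the iterates stay in a
  compact subset of the interior of its domain; \<open>E\<close> is constant and equal to \<open>lim e\<close> on the
  cluster points, all of which have \<open>0\<close> as a subgradient. As there is no control on the distance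
  between successive \<open>y k\<close>, the KL inequality at a single cluster point does not suffice: the
  desingularizing functions of finitely many cluster points are added up. The usual telescoping
  argument then shows that the iterates have finite length.\<close>

section \<open>Convex subgradients\<close>

text \<open>Finiteness at \<open>x\<close> is demanded because at a point with value
  \<open>-\<infinity>\<close> every \<open>v\<close> would satisfy the inequality.\<close>

definition convex_subgradient :: "('a::real_inner \<Rightarrow> ereal) \<Rightarrow> 'a \<Rightarrow> 'a \<Rightarrow> bool" where
  "convex_subgradient h x v \<longleftrightarrow> \<bar>h x\<bar> \<noteq> \<infinity> \<and> (\<forall>u. h x + ereal (v \<bullet> (u - x)) \<le> h u)"

text \<open>After division by \<open>norm (z - x)\<close> the quadratic error is still of order
  \<open>norm (z - x)\<close> and vanishes in the liminf. The slack serves the merit function, which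
  is not convex in general; \<open>C = 0\<close> covers convex subgradients.\<close>

lemma frechet_subdiff_quadratic_minorant:
  fixes h :: "'a::euclidean_space \<Rightarrow> ereal"
  assumes fin: "\<bar>h x\<bar> \<noteq> \<infinity>" and C: "0 \<le> C"
    and minorant: "\<And>z. h x + ereal (v \<bullet> (z - x) - C * (norm (z - x))\<^sup>2) \<le> h z"
  shows "v \<in> frechet_subdiff h x"
proof -
  obtain a where a: "h x = ereal a"
    using fin by auto
  let ?q = "\<lambda>z. (h z - h x - ereal (v \<bullet> (z - x))) / ereal (norm (z - x))"
  have "\<forall>\<^sub>F z in at x. b < ?q z" if b: "b < 0" for b :: ereal
  proof -
    obtain e where e: "b < ereal e" "e < 0"
      using ereal_dense2[OF b] by (auto simp: zero_ereal_def)
    \<comment> \<open>Chosen to make \<open>C * norm (z - x) < - e\<close>; the summand 1 keeps the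
      divisor positive when \<open>C = 0\<close>.\<close>
    define \<delta> where "\<delta> = - e / (C + 1)"
    have \<delta>: "0 < \<delta>"
      unfolding \<delta>_def using e C by (intro divide_pos_pos) auto
    have "ereal e < ?q z" if z: "z \<noteq> x" "dist z x < \<delta>" for z
    proof -
      let ?n = "norm (z - x)"
      have n: "0 < ?n" "?n < \<delta>"
        using z by (auto simp: dist_norm)
      have Cn: "C * ?n < - e"
      proof -
        have "C * ?n \<le> (C + 1) * ?n"
          using n by (intro mult_right_mono) auto
        also have "\<dots> < (C + 1) * \<delta>"
          using n C by (intro mult_strict_left_mono) auto
        also have "\<dots> = - e"
          using C by (simp add: \<delta>_def)
        finally show ?thesis .
      qed
      show ?thesis
      proof (cases "h z")
        case (real r)
        have "a + (v \<bullet> (z - x) - C * ?n\<^sup>2) \<le> r"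
          using minorant[of z] by (simp add: a real)
        moreover have "C * ?n * ?n < (- e) * ?n"
          using Cn n by (intro mult_strict_right_mono) auto
        ultimately have "e * ?n < r - a - v \<bullet> (z - x)"
          by (simp add: power2_eq_square)
        then have "e < (r - a - v \<bullet> (z - x)) / ?n"
          using n by (simp add: pos_less_divide_eq)
        then show ?thesis
          using n by (simp add: a real)
      next
        case PInf
        then show ?thesis
          using n by (simp add: a divide_ereal_def)
      next
        case MInf
        then show ?thesis
          using minorant[of z] by (simp add: a)
      qed
    qed
    then show ?thesis
      unfolding eventually_at using \<delta> e(1) by (intro exI[of _ \<delta>]) (auto intro: less_trans)
  qed
  then show ?thesis
    unfolding frechet_subdiff_def using fin by (auto simp: le_Liminf_iff edom_def)
qed

lemma frechet_subdiff_imp_subdiff: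
  assumes "v \<in> frechet_subdiff h x"
  shows "v \<in> subdiff h x"
  unfolding subdiff_def mem_Collect_eq
proof (intro conjI exI)
  show "x \<in> edom h"
    using assms by (auto simp: frechet_subdiff_def)
  show "(\<lambda>j::nat. x) \<longlonglongrightarrow> x" "(\<lambda>j::nat. h x) \<longlonglongrightarrow> h x" "(\<lambda>j::nat. v) \<longlonglongrightarrow> v"
    by simp_all
qed (use assms in simp)

lemma convex_subgradient_imp_subdiff:
  assumes "convex_subgradient h x v"
  shows "v \<in> subdiff h x"
  using assms
  by (intro frechet_subdiff_imp_subdiff frechet_subdiff_quadratic_minorant[where C = 0])
     (auto simp: convex_subgradient_def)

lemma convex_fun_segment:
  assumes "convex_fun h" "h x = ereal a" "h u = ereal b" "0 \<le> t" "t \<le> 1"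
  shows "h (x + t *\<^sub>R (u - x)) \<le> ereal (a + t * (b - a))"
proof -
  have "(1 - t) *\<^sub>R (x, a) + t *\<^sub>R (u, b) \<in> epigraph_ereal h"
    using assms unfolding convex_fun_def
    by (intro convexD) (auto simp: epigraph_ereal_def)
  then show ?thesis
    by (simp add: epigraph_ereal_def algebra_simps)
qed

text \<open>If the subgradient inequality failed at some \<open>u\<close>, convexity would transport
  the failure along the segment to points arbitrarily close to \<open>x\<close>, with an
  undiminished negative slope, against the liminf condition.\<close>

lemma frechet_subdiff_imp_convex_subgradient:
  assumes h: "proper_fun h" "convex_fun h" and v: "v \<in> frechet_subdiff h x"
  shows "convex_subgradient h x v"
proof -
  have notMInf: "h u \<noteq> - \<infinity>" for u
    using h(1) by (simp add: proper_fun_def)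
  have "h x < \<infinity>"
    using v by (simp add: frechet_subdiff_def edom_def)
  then obtain a where a: "h x = ereal a"
    using notMInf[of x] by (cases "h x") auto
  have "h x + ereal (v \<bullet> (u - x)) \<le> h u" for u
  proof (cases "h u")
    case (real b)
    show ?thesis
    proof (rule ccontr)
      assume "\<not> ?thesis"
      then have b: "b < a + v \<bullet> (u - x)"
        by (simp add: a real)
      then have "u \<noteq> x"
        using real a by auto
      let ?n = "norm (u - x)" and ?q = "\<lambda>z. (h z - h x - ereal (v \<bullet> (z - x))) / ereal (norm (z - x))"
      \<comment> \<open>The slope of the failure per unit distance; by convexity the difference
        quotient along the segment is at most \<open>e\<close>.\<close>
      define e where "e = (b - a - v \<bullet> (u - x)) / ?n"
      have n: "0 < ?n"
        using \<open>u \<noteq> x\<close> by simp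
      then have "e < 0"
        using b by (simp add: e_def divide_neg_pos)
      then have "ereal e < 0"
        by (simp add: zero_ereal_def)
      then have "\<forall>\<^sub>F z in at x. ereal e < ?q z"
        using v by (auto simp: frechet_subdiff_def le_Liminf_iff)
      then obtain d where d: "d > 0" "\<And>z. z \<noteq> x \<Longrightarrow> dist z x < d \<Longrightarrow> ereal e < ?q z"
        by (auto simp: eventually_at)
      define t where "t = min 1 (d / (2 * ?n))"
      have t: "0 < t" "t \<le> 1" "t * ?n < d"
      proof -
        show "0 < t" "t \<le> 1"
          using d(1) n by (auto simp: t_def)
        have "t * ?n \<le> d / (2 * ?n) * ?n"
          using n by (intro mult_right_mono) (auto simp: t_def)
        also have "\<dots> < d"
          using n d(1) by simp
        finally show "t * ?n < d" .
      qed
      let ?z = "x + t *\<^sub>R (u - x)"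
      have le: "h ?z \<le> ereal (a + t * (b - a))"
        using convex_fun_segment[OF h(2) a real] t by simp
      then obtain r where r: "h ?z = ereal r"
        using notMInf[of ?z] by (cases "h ?z") auto
      have "ereal e < ?q ?z"
        using t n \<open>u \<noteq> x\<close> by (intro d(2)) (auto simp: dist_norm)
      then have "e < (r - a - t * (v \<bullet> (u - x))) / (t * ?n)"
        using t(1) n by (simp add: r a)
      then have "e * (t * ?n) < r - a - t * (v \<bullet> (u - x))"
        using t(1) n by (simp add: pos_less_divide_eq)
      also have "\<dots> \<le> t * (b - a) - t * (v \<bullet> (u - x))"
        using le by (simp add: r)
      also have "\<dots> = e * (t * ?n)"
        using n by (simp add: e_def field_simps)
      finally show False by simp
    qed
  qed (use notMInf in auto)
  then show ?thesis
    by (simp add: convex_subgradient_def a)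
qed

text \<open>Convergence of the values \<open>h (X j)\<close> lets the inequality pass to the limit,
  since \<open>h\<close> need not be continuous. For the limiting subdifferential it is part of the
  definition; for the iterates it has to be established.\<close>

lemma convex_subgradient_limit:
  assumes sub: "\<And>j::nat. convex_subgradient h (X j) (V j)"
    and X: "X \<longlonglongrightarrow> x" and V: "V \<longlonglongrightarrow> v"
    and hX: "(\<lambda>j. h (X j)) \<longlonglongrightarrow> h x" and fin: "\<bar>h x\<bar> \<noteq> \<infinity>"
  shows "convex_subgradient h x v"
  unfolding convex_subgradient_def
proof (intro conjI allI fin)
  fix u
  have "(\<lambda>j. ereal (V j \<bullet> (u - X j))) \<longlonglongrightarrow> ereal (v \<bullet> (u - x))"
    using X V by (intro tendsto_intros)
  then have "(\<lambda>j. h (X j) + ereal (V j \<bullet> (u - X j))) \<longlonglongrightarrow> h x + ereal (v \<bullet> (u - x))"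
    using hX fin by (intro tendsto_add_ereal_general) auto
  then show "h x + ereal (v \<bullet> (u - x)) \<le> h u"
    using sub by (intro LIMSEQ_le_const2) (auto simp: convex_subgradient_def)
qed

lemma subdiff_iff_convex_subgradient:
  assumes h: "proper_fun h" "convex_fun h"
  shows "v \<in> subdiff h x \<longleftrightarrow> convex_subgradient h x v"
proof
  assume "v \<in> subdiff h x"
  then obtain X V where *: "x \<in> edom h" "X \<longlonglongrightarrow> x" "(\<lambda>j. h (X j)) \<longlonglongrightarrow> h x"
      "\<And>j::nat. V j \<in> frechet_subdiff h (X j)" "V \<longlonglongrightarrow> v"
    unfolding subdiff_def by auto
  have "\<bar>h x\<bar> \<noteq> \<infinity>"
    using *(1) h(1) by (auto simp: edom_def proper_fun_def)
  moreover have "convex_subgradient h (X j) (V j)" for j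
    using *(4) h by (intro frechet_subdiff_imp_convex_subgradient)
  ultimately show "convex_subgradient h x v"
    using * by - (rule convex_subgradient_limit[of h X V])
qed (rule convex_subgradient_imp_subdiff)

text \<open>At \<open>t *\<^sub>R u + (1 - t) *\<^sub>R x\<close> the function is bounded above by
  \<sigma>-convexity and below by the subgradient; dividing by \<open>t\<close> and letting
  \<open>t\<close> tend to 0 leaves the full quadratic gain.\<close>

lemma convex_subgradient_strong:
  assumes s: "sigma_convex \<sigma> h" and v: "convex_subgradient h x v"
    and a: "h x = ereal a" and b: "h u = ereal b"
  shows "a + v \<bullet> (u - x) + \<sigma> / 2 * (norm (u - x))\<^sup>2 \<le> b"
proof -
  let ?c = "\<sigma> / 2 * (norm (u - x))\<^sup>2"
  have ineq: "v \<bullet> (u - x) + (1 - t) * ?c \<le> b - a" if t: "0 < t" "t \<le> 1" for t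
  proof -
    let ?z = "t *\<^sub>R u + (1 - t) *\<^sub>R x"
    have z: "?z - x = t *\<^sub>R (u - x)"
      by (simp add: algebra_simps)
    have "h ?z \<le> ereal (t * b + (1 - t) * a - \<sigma> / 2 * t * (1 - t) * (norm (u - x))\<^sup>2)"
      using s[unfolded sigma_convex_def, rule_format, of u x t] t a b by (simp add: edom_def)
    moreover have "ereal (a + t * (v \<bullet> (u - x))) \<le> h ?z"
      using v[unfolded convex_subgradient_def, THEN conjunct2, rule_format, of ?z]
      by (simp only: a z) simp
    ultimately have "ereal (a + t * (v \<bullet> (u - x)))
        \<le> ereal (t * b + (1 - t) * a - \<sigma> / 2 * t * (1 - t) * (norm (u - x))\<^sup>2)"
      by (rule order_trans[rotated])
    then have "t * (v \<bullet> (u - x) + (1 - t) * ?c) \<le> t * (b - a)"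
      by (simp add: algebra_simps)
    then show ?thesis
      using t(1) by simp
  qed
  have lim: "((\<lambda>t. v \<bullet> (u - x) + (1 - t) * ?c) \<longlongrightarrow> v \<bullet> (u - x) + (1 - 0) * ?c) (at_right 0)"
    by (intro tendsto_intros)
  have "v \<bullet> (u - x) + (1 - 0) * ?c \<le> b - a"
  proof (rule tendsto_upperbound[OF lim])
    show "\<forall>\<^sub>F t in at_right 0. v \<bullet> (u - x) + (1 - t) * ?c \<le> b - a"
      unfolding eventually_at_right_field using ineq by (intro exI[of _ 1]) auto
  qed simp
  then show ?thesis by simp
qed

section \<open>Conjugates, and regularity in the interior of the domain\<close>

lemma conjugate_fun_at_subgradient:
  assumes v: "convex_subgradient h x v" and a: "h x = ereal a"
  shows "conjugate_fun h v = ereal (v \<bullet> x - a)"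
  unfolding conjugate_fun_def
\<comment> \<open>Fenchel equality: the subgradient inequality says exactly that the supremum is
  attained at \<open>x\<close>.\<close>
proof (rule SUP_eqI)
  fix u
  show "ereal (v \<bullet> u) - h u \<le> ereal (v \<bullet> x - a)"
    using v[unfolded convex_subgradient_def, THEN conjunct2, rule_format, of u] a
    by (cases "h u") (auto simp: inner_diff_right)
next
  fix w
  assume "\<And>u. u \<in> UNIV \<Longrightarrow> ereal (v \<bullet> u) - h u \<le> w"
  from this[of x] show "ereal (v \<bullet> x - a) \<le> w"
    by (simp add: a)
qed

lemma conjugate_fun_ge:
  assumes "h x = ereal a"
  shows "ereal (w \<bullet> x - a) \<le> conjugate_fun h w"
  unfolding conjugate_fun_def by (rule SUP_upper2[of x]) (auto simp: assms)

text \<open>A real convex function on an open set of a finite-dimensional space is continuous. A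
  proper function is finite on its domain, so \<open>real_of_ereal\<close> is faithful there and
  epigraph convexity turns into \<open>convex_on\<close>.\<close>

lemma continuous_on_real_of_convex_fun:
  fixes h :: "'a::euclidean_space \<Rightarrow> ereal"
  assumes "proper_fun h" "convex_fun h"
  shows "continuous_on (interior (edom h)) (\<lambda>u. real_of_ereal (h u))"
proof (rule convex_on_continuous)
  have fin: "h u = ereal (real_of_ereal (h u))" if "u \<in> edom h" for u
    using that assms(1) by (cases "h u") (auto simp: edom_def proper_fun_def)
  have seg: "h (v + t *\<^sub>R (u - v)) \<le>
      ereal (real_of_ereal (h v) + t * (real_of_ereal (h u) - real_of_ereal (h v)))"
    if "u \<in> edom h" "v \<in> edom h" "0 \<le> t" "t \<le> 1" for u v t
    using convex_fun_segment[OF assms(2) fin fin] that by blast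
  have conv: "convex (edom h)"
    unfolding convex_alt
  proof (intro ballI allI impI)
    fix v u and t :: real
    assume "v \<in> edom h" "u \<in> edom h" "0 \<le> t \<and> t \<le> 1"
    then have "h (v + t *\<^sub>R (u - v)) < \<infinity>"
      using seg[of u v t] by (auto intro: le_less_trans)
    then show "(1 - t) *\<^sub>R v + t *\<^sub>R u \<in> edom h"
      by (simp add: edom_def algebra_simps)
  qed
  have on: "convex_on (edom h) (\<lambda>u. real_of_ereal (h u))"
  proof (rule convex_onI[OF _ conv])
    fix t :: real and v u
    assume *: "0 < t" "t < 1" "v \<in> edom h" "u \<in> edom h"
    let ?z = "(1 - t) *\<^sub>R v + t *\<^sub>R u"
    have "?z \<in> edom h"
      using conv * by (auto simp: convex_alt)
    moreover have "h ?z \<le> ereal (real_of_ereal (h v) + t * (real_of_ereal (h u) - real_of_ereal (h v)))"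
      using seg[of u v t] * by (simp add: algebra_simps)
    ultimately have "real_of_ereal (h ?z) \<le> real_of_ereal (h v) + t * (real_of_ereal (h u) - real_of_ereal (h v))"
      using fin[of ?z] by (metis ereal_less_eq(3))
    then show "real_of_ereal (h ?z) \<le> (1 - t) * real_of_ereal (h v) + t * real_of_ereal (h u)"
      by (simp add: algebra_simps)
  qed
  show "convex_on (interior (edom h)) (\<lambda>u. real_of_ereal (h u))"
    using on by (rule convex_on_subset) (simp_all add: interior_subset convex_interior conv)
qed simp

text \<open>A step of fixed length \<open>e\<close> in the direction of a subgradient
  \<open>v\<close> raises \<open>h\<close> by at least \<open>e * norm v\<close>, while
  \<open>h\<close> varies by at most \<open>2 * M\<close> on a compact neighbourhood of
  \<open>K\<close>.\<close>

lemma bounded_convex_subgradients: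
  fixes h :: "'a::euclidean_space \<Rightarrow> ereal"
  assumes h: "proper_fun h" "convex_fun h" and K: "compact K" "K \<subseteq> interior (edom h)"
  shows "bounded {v. \<exists>u\<in>K. convex_subgradient h u v}"
proof -
  obtain e where e: "e > 0" "(\<Union>u\<in>K. cball u e) \<subseteq> interior (edom h)"
    using compact_subset_open_imp_cball_epsilon_subset[OF K(1) open_interior K(2)] by blast
  let ?C = "\<Union>u\<in>K. cball u e"
  have "compact ((\<lambda>u. real_of_ereal (h u)) ` ?C)"
    using continuous_on_subset[OF continuous_on_real_of_convex_fun[OF h] e(2)]
      compact_minkowski_sum_cball[OF K(1), of e] by (rule compact_continuous_image)
  from compact_imp_bounded[OF this] obtain M where M: "\<And>u. u \<in> ?C \<Longrightarrow> \<bar>real_of_ereal (h u)\<bar> \<le> M"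
    unfolding bounded_real by blast
  have "norm v \<le> 2 * M / e" if u: "u \<in> K" and v: "convex_subgradient h u v" for u v
  proof -
    \<comment> \<open>For \<open>v = 0\<close> division by zero yields \<open>z = u\<close>, so no
      case distinction arises.\<close>
    define z where "z = u + (e / norm v) *\<^sub>R v"
    have C: "u \<in> ?C" "z \<in> ?C"
      using u e(1) by (auto intro!: bexI[of _ u] simp: z_def dist_norm)
    have "v \<bullet> (z - u) = e * norm v"
      by (simp add: z_def power2_norm_eq_inner[symmetric] power2_eq_square)
    moreover have "h u + ereal (v \<bullet> (z - u)) \<le> h z"
      using v by (simp add: convex_subgradient_def)
    moreover have "u \<in> edom h" "z \<in> edom h"
      using C e(2) interior_subset by blast+
    then have "h u \<noteq> - \<infinity>" "h z \<noteq> - \<infinity>" "h u \<noteq> \<infinity>" "h z \<noteq> \<infinity>"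
      using h(1) by (auto simp: edom_def proper_fun_def)
    ultimately have "real_of_ereal (h u) + e * norm v \<le> real_of_ereal (h z)"
      by (cases "h u"; cases "h z") auto
    then have "e * norm v \<le> 2 * M"
      using M[OF C(1)] M[OF C(2)] by linarith
    then show ?thesis
      using e(1) by (simp add: field_simps)
  qed
  then show ?thesis
    unfolding bounded_iff by blast
qed


section \<open>The KL inequality along a bounded sequence\<close>

text \<open>The KL inequality integrated by concavity of the desingularizing function. Unlike the
  differential form, it passes to finite sums of such functions without further ado.\<close>

definition integrated_KL ::
  "('a::euclidean_space \<Rightarrow> ereal) \<Rightarrow> real \<Rightarrow> real \<Rightarrow> (real \<Rightarrow> real) \<Rightarrow> 'a set \<Rightarrow> bool" where
  "integrated_KL h \<zeta> \<eta> \<psi> U \<longleftrightarrow>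
     (\<forall>t. 0 \<le> t \<and> t < \<eta> \<longrightarrow> 0 \<le> \<psi> t) \<and>
     (\<forall>s t. 0 \<le> t \<and> t \<le> s \<and> s < \<eta> \<longrightarrow> \<psi> t \<le> \<psi> s) \<and>
     (\<forall>p\<in>U. \<forall>s t d. h p = ereal (\<zeta> + s) \<and> 0 < s \<and> s < \<eta> \<and> 0 \<le> t \<and> t \<le> s \<and>
        edist_set 0 (subdiff h p) \<le> ereal d \<longrightarrow> s - t \<le> (\<psi> s - \<psi> t) * d)"

text \<open>Concavity puts \<open>\<phi>\<close> below its tangents, so
  \<open>deriv \<phi> s * (s - t)\<close> is at most \<open>\<phi> s - \<phi> t\<close>; the KL
  inequality \<open>1 \<le> deriv \<phi> s * d\<close> then removes the derivative.\<close>

lemma KL_property_at_imp_integrated_KL: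
  assumes KL: "KL_property_at h q" and q: "h q = ereal \<zeta>"
  shows "\<exists>\<eta>>0. \<exists>U \<psi>. open U \<and> q \<in> U \<and> integrated_KL h \<zeta> \<eta> \<psi> U"
proof -
  obtain \<eta>' U \<phi> where \<eta>': "0 < \<eta>'" and \<phi>: "\<phi> \<in> desingularizing \<eta>'" and U: "open U" "q \<in> U"
    and ineq: "\<And>p. p \<in> U \<Longrightarrow> h q < h p \<Longrightarrow> h p < h q + \<eta>' \<Longrightarrow>
      1 \<le> ereal (deriv \<phi> (real_of_ereal (h p - h q))) * edist_set 0 (subdiff h p)"
    using KL unfolding KL_property_at_def by blast
  obtain \<eta> where \<eta>: "0 < \<eta>" "ereal \<eta> < \<eta>'"
    using ereal_dense2[OF \<eta>'] by auto
  let ?I = "{t. 0 \<le> t \<and> ereal t < \<eta>'}"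
  have I: "t \<in> ?I" if "0 \<le> t" "t < \<eta>" for t
    using that \<eta> by (auto intro: less_trans[of "ereal t" "ereal \<eta>"])
  have deriv_pos: "0 < deriv \<phi> s" if "0 < s" "s < \<eta>" for s
    using \<phi> I[of s] that by (auto simp: desingularizing_def)
  have tangent: "deriv \<phi> s * (s - t) \<le> \<phi> s - \<phi> t" if s: "0 < s" "s < \<eta>" and t: "0 \<le> t" "t < \<eta>" for s t
  proof -
    \<comment> \<open>Tangent inequality for the convex function \<open>- \<phi>\<close>. It is
      taken at the interior point \<open>s\<close>, so \<open>t = 0\<close>, where
      \<open>\<phi>\<close> need not be differentiable, is allowed.\<close>
    have "(- \<phi> t) - (- \<phi> s) \<ge> (- deriv \<phi> s) * (t - s)"
    proof (rule convex_on_imp_above_tangent[where A = ?I and f = "\<lambda>x. - \<phi> x"])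
      show "convex_on ?I (\<lambda>x. - \<phi> x)"
        using \<phi> by (simp add: desingularizing_def concave_on_def)
      show "connected ?I"
        by (rule is_interval_connected)
           (auto simp: is_interval_1 intro: le_less_trans[of "ereal _" "ereal _"])
      have "{0<..<\<eta>} \<subseteq> ?I"
        using I by auto
      then show "s \<in> interior ?I"
        using s by (intro interiorI[of "{0<..<\<eta>}"]) auto
      show "t \<in> ?I"
        using I t by auto
      have "\<phi> differentiable at s"
        using \<phi> I[of s] s by (auto simp: desingularizing_def)
      then have "(\<phi> has_field_derivative deriv \<phi> s) (at s within ?I)"
        using DERIV_deriv_iff_real_differentiable has_field_derivative_at_within by blast
      then show "((\<lambda>x. - \<phi> x) has_field_derivative - deriv \<phi> s) (at s within ?I)"
        by (rule DERIV_minus)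
    qed
    then show ?thesis
      by (simp add: algebra_simps)
  qed
  have "integrated_KL h \<zeta> \<eta> \<phi> U"
    unfolding integrated_KL_def
  proof (intro conjI allI ballI impI)
    fix t assume "0 \<le> t \<and> t < \<eta>"
    then show "0 \<le> \<phi> t"
      using \<phi> I[of t] by (auto simp: desingularizing_def)
  next
    fix s t assume *: "0 \<le> t \<and> t \<le> s \<and> s < \<eta>"
    show "\<phi> t \<le> \<phi> s"
    proof (cases "t = s")
      case False
      then have "0 \<le> deriv \<phi> s * (s - t)"
        using * deriv_pos[of s] by simp
      then show ?thesis
        using tangent[of s t] False * by simp
    qed simp
  next
    fix p s t d
    assume p: "p \<in> U" and "h p = ereal (\<zeta> + s) \<and> 0 < s \<and> s < \<eta> \<and> 0 \<le> t \<and> t \<le> s \<and>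
        edist_set 0 (subdiff h p) \<le> ereal d"
    then have *: "h p = ereal (\<zeta> + s)" "0 < s" "s < \<eta>" "0 \<le> t" "t \<le> s"
        "edist_set 0 (subdiff h p) \<le> ereal d"
      by auto
    have "h q < h p"
      using * q by simp
    moreover have "h p < h q + \<eta>'"
      using * q I[of s] by (cases \<eta>') auto
    ultimately have "1 \<le> ereal (deriv \<phi> s) * edist_set 0 (subdiff h p)"
      using ineq[OF p] * q by simp
    also have "\<dots> \<le> ereal (deriv \<phi> s) * ereal d"
      using * deriv_pos[of s] by (intro ereal_mult_left_mono) auto
    finally have 1: "1 \<le> deriv \<phi> s * d"
      by (simp add: one_ereal_def)
    then have "0 < d"
      using deriv_pos[of s] * by (metis less_le_trans zero_less_mult_pos zero_less_one)
    have "(s - t) * 1 \<le> (s - t) * (deriv \<phi> s * d)"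
      using 1 * by (intro mult_left_mono) auto
    also have "\<dots> = (deriv \<phi> s * (s - t)) * d"
      by simp
    also have "\<dots> \<le> (\<phi> s - \<phi> t) * d"
      using tangent[of s t] * \<open>0 < d\<close> by (intro mult_right_mono) auto
    finally show "s - t \<le> (\<phi> s - \<phi> t) * d"
      by simp
  qed
  then show ?thesis
    using \<eta>(1) U by blast
qed

text \<open>At a point of \<open>U q\<close> the inequality for \<open>q\<close> applies, and since
  every summand is monotone its increment is at most that of the sum; \<open>d\<close> is
  nonnegative as an upper bound of a distance.\<close>

lemma integrated_KL_Union:
  assumes fin: "finite F" "F \<noteq> {}"
    and sur: "\<And>q. q \<in> F \<Longrightarrow> integrated_KL h \<zeta> (\<eta> q) (\<psi> q) (U q)"
  shows "integrated_KL h \<zeta> (Min (\<eta> ` F)) (\<lambda>t. \<Sum>q\<in>F. \<psi> q t) (\<Union>q\<in>F. U q)"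
proof -
  have lt: "t < \<eta> q" if "t < Min (\<eta> ` F)" "q \<in> F" for t q
    using that fin by (simp add: Min_gr_iff)
  have mono: "\<psi> q t \<le> \<psi> q s" if "q \<in> F" "0 \<le> t" "t \<le> s" "s < Min (\<eta> ` F)" for q s t
    using sur[OF that(1)] that lt[of s q] by (simp add: integrated_KL_def)
  show ?thesis
    unfolding integrated_KL_def
  proof (intro conjI allI ballI impI)
    fix t assume "0 \<le> t \<and> t < Min (\<eta> ` F)"
    then show "0 \<le> (\<Sum>q\<in>F. \<psi> q t)"
      using sur lt by (intro sum_nonneg) (simp add: integrated_KL_def)
  next
    fix s t assume "0 \<le> t \<and> t \<le> s \<and> s < Min (\<eta> ` F)"
    then show "(\<Sum>q\<in>F. \<psi> q t) \<le> (\<Sum>q\<in>F. \<psi> q s)"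
      using mono by (intro sum_mono) auto
  next
    fix p s t d
    assume "p \<in> (\<Union>q\<in>F. U q)" and "h p = ereal (\<zeta> + s) \<and> 0 < s \<and> s < Min (\<eta> ` F) \<and> 0 \<le> t \<and> t \<le> s \<and>
        edist_set 0 (subdiff h p) \<le> ereal d"
    then obtain q where q: "q \<in> F" "p \<in> U q"
      and *: "h p = ereal (\<zeta> + s)" "0 < s" "s < Min (\<eta> ` F)" "0 \<le> t" "t \<le> s"
        "edist_set 0 (subdiff h p) \<le> ereal d"
      by auto
    have "(0::ereal) \<le> edist_set 0 (subdiff h p)"
      unfolding edist_set_def by (intro INF_greatest) auto
    then have "0 \<le> d"
      using *(6) by (metis ereal_less_eq(5) order_trans)
    have "s - t \<le> (\<psi> q s - \<psi> q t) * d"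
      using sur[OF q(1)] q * lt[of s q] unfolding integrated_KL_def by blast
    also have "\<psi> q s - \<psi> q t \<le> (\<Sum>q\<in>F. \<psi> q s - \<psi> q t)"
      using fin q * mono by (intro member_le_sum) auto
    then have "(\<psi> q s - \<psi> q t) * d \<le> (\<Sum>q\<in>F. \<psi> q s - \<psi> q t) * d"
      using \<open>0 \<le> d\<close> by (intro mult_right_mono)
    finally show "s - t \<le> ((\<Sum>q\<in>F. \<psi> q s) - (\<Sum>q\<in>F. \<psi> q t)) * d"
      by (simp add: sum_subtractf)
  qed
qed

text \<open>Points that are not cluster points are covered by neighbourhoods which the sequence
  eventually avoids, so that a single compactness argument yields the uniformity.\<close>

lemma integrated_KL_along_bounded_sequence:
  fixes p :: "nat \<Rightarrow> 'a::euclidean_space"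
  assumes bdd: "bounded (range p)"
    and cluster: "\<And>q r. strict_mono (r::nat \<Rightarrow> nat) \<Longrightarrow> (p \<circ> r) \<longlonglongrightarrow> q \<Longrightarrow>
      h q = ereal \<zeta> \<and> KL_property_at h q"
  shows "\<exists>\<eta>>0. \<exists>U \<psi>. integrated_KL h \<zeta> \<eta> \<psi> U \<and> (\<forall>\<^sub>F k in sequentially. p k \<in> U)"
proof -
  let ?K = "closure (range p)"
  define \<Omega> where "\<Omega> = {q. \<exists>\<eta>>0. \<exists>U \<psi>. open U \<and> q \<in> U \<and> integrated_KL h \<zeta> \<eta> \<psi> U}"
  \<comment> \<open>Contraposition: a point visited infinitely often in each of its neighbourhoods
    is the limit of a subsequence and hence lies in \<open>\<Omega>\<close>.\<close>
  have avoid: "\<exists>W. open W \<and> q \<in> W \<and> (\<forall>\<^sub>F k in sequentially. p k \<notin> W)" if "q \<notin> \<Omega>" for q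
  proof (rule ccontr)
    assume "\<not> ?thesis"
    then have freq: "\<exists>k>N. p k \<in> W" if "open W" "q \<in> W" for W N
      using that unfolding eventually_sequentially by (metis Suc_le_eq)
    then have close: "\<exists>k>N. dist (p k) q < e" if "e > 0" for e N
      using that freq[of "ball q e"] by (auto simp: dist_commute)
    have "\<exists>r. \<forall>n. dist (p (r n)) q < inverse (real (Suc n)) \<and> r n < r (Suc n)"
    proof (rule dependent_nat_choice)
      show "\<exists>k. dist (p k) q < inverse (real (Suc 0))"
        using close[of 1] by auto
      show "\<exists>k'. dist (p k') q < inverse (real (Suc (Suc n))) \<and> k < k'" for k n
        using close[of "inverse (real (Suc (Suc n)))" k] by auto
    qed
    then obtain r where r: "\<And>n. dist (p (r n)) q < inverse (real (Suc n))" "strict_mono r"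
      by (auto simp: strict_mono_Suc_iff)
    have "(\<lambda>n. dist (p (r n)) q) \<longlonglongrightarrow> 0"
      using r(1) by (intro tendsto_sandwich[OF _ _ tendsto_const LIMSEQ_inverse_real_of_nat])
        (auto intro!: always_eventually less_imp_le)
    then have "(p \<circ> r) \<longlonglongrightarrow> q"
      by (simp add: tendsto_dist_iff[of _ q])
    then have "q \<in> \<Omega>"
      using cluster[OF r(2)] KL_property_at_imp_integrated_KL[of h q \<zeta>] by (simp add: \<Omega>_def)
    with \<open>q \<notin> \<Omega>\<close> show False ..
  qed
  have "\<forall>q\<in>\<Omega>. \<exists>\<eta> U \<psi>. 0 < \<eta> \<and> open U \<and> q \<in> U \<and> integrated_KL h \<zeta> \<eta> \<psi> U"
    unfolding \<Omega>_def by blast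
  then obtain \<eta> U \<psi> where \<Omega>: "\<And>q. q \<in> \<Omega> \<Longrightarrow> 0 < \<eta> q \<and> open (U q) \<and> q \<in> U q \<and> integrated_KL h \<zeta> (\<eta> q) (\<psi> q) (U q)"
    unfolding bchoice_iff by blast
  obtain W where W: "\<And>q. q \<notin> \<Omega> \<Longrightarrow> open (W q) \<and> q \<in> W q \<and> (\<forall>\<^sub>F k in sequentially. p k \<notin> W q)"
    using avoid by metis
  define V where "V q = (if q \<in> \<Omega> then U q else W q)" for q
  have V: "open (V q)" "q \<in> V q" for q
    using \<Omega>[of q] W[of q] by (auto simp: V_def)
  have "compact ?K"
    using bdd by (simp add: compact_closure)
  moreover have "?K \<subseteq> (\<Union>q\<in>?K. V q)"
    using V(2) by blast
  ultimately obtain F where F: "finite F" "?K \<subseteq> (\<Union>q\<in>F. V q)"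
    using compactE_image[of ?K ?K V] V(1) by metis
  have "\<forall>\<^sub>F k in sequentially. \<forall>q\<in>F - \<Omega>. p k \<notin> W q"
    using F(1) W by (intro eventually_ball_finite) auto
  then have ev: "\<forall>\<^sub>F k in sequentially. p k \<in> (\<Union>q\<in>F \<inter> \<Omega>. U q)"
  proof (rule eventually_mono)
    fix k assume *: "\<forall>q\<in>F - \<Omega>. p k \<notin> W q"
    have "p k \<in> (\<Union>q\<in>F. V q)"
      using F(2) subsetD[OF closure_subset[of "range p"], of "p k"] by auto
    then show "p k \<in> (\<Union>q\<in>F \<inter> \<Omega>. U q)"
      using * by (auto simp: V_def split: if_splits)
  qed
  \<comment> \<open>Some \<open>p k\<close> lies in the union, so its index set is nonempty, as
    \<open>Min\<close> requires.\<close>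
  have F\<Omega>: "finite (F \<inter> \<Omega>)" "F \<inter> \<Omega> \<noteq> {}"
    using F(1) eventually_happens'[OF sequentially_bot ev] by auto
  have "integrated_KL h \<zeta> (Min (\<eta> ` (F \<inter> \<Omega>))) (\<lambda>t. \<Sum>q\<in>F \<inter> \<Omega>. \<psi> q t) (\<Union>q\<in>F \<inter> \<Omega>. U q)"
    using F\<Omega> \<Omega> by (intro integrated_KL_Union) auto
  moreover have "0 < Min (\<eta> ` (F \<inter> \<Omega>))"
    using F\<Omega> \<Omega> by auto
  ultimately show ?thesis
    using ev by blast
qed

section \<open>Finite length from descent and the KL inequality\<close>

lemma summable_of_telescoping_bound:
  fixes d \<Psi> :: "nat \<Rightarrow> real"
  assumes d: "\<And>k. 0 \<le> d k" and \<Psi>: "\<And>k. N \<le> k \<Longrightarrow> 0 \<le> \<Psi> k"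
    and step: "\<And>k. N \<le> k \<Longrightarrow> 3/4 * d (Suc k) \<le> \<Psi> k - \<Psi> (Suc k) + d k / 4"
  shows "summable d"
proof -
  \<comment> \<open>The term \<open>d (N + n) / 4\<close> carried on the left pays for
    \<open>d k / 4\<close> in the next step, so half of each summand survives.\<close>
  have bound: "(\<Sum>j<n. d (Suc N + j)) / 2 + d (N + n) / 4 \<le> \<Psi> N - \<Psi> (N + n) + d N / 4" for n
  proof (induction n)
    case (Suc n)
    then show ?case
      using step[of "N + n"] by (simp add: add_divide_distrib)
  qed simp
  have "(\<Sum>j<n. d (Suc N + j)) \<le> 2 * \<Psi> N + d N / 2" for n
    using bound[of n] \<Psi>[OF le_add1, of n] d[of "N + n"] by linarith
  then have "summable (\<lambda>j. d (Suc N + j))"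
    using d by (intro summableI_nonneg_bounded) auto
  then show ?thesis
    using summable_iff_shift[of d "Suc N"] by (simp add: add.commute)
qed

text \<open>Descent bounds the square of a step by a decrease of \<open>e\<close>, and the KL
  inequality bounds that decrease by a decrease of \<open>\<psi>\<close> times the sum of two
  consecutive steps. Taking roots leaves a telescoping bound.\<close>

lemma summable_of_KL_descent:
  fixes d e :: "nat \<Rightarrow> real"
  assumes c: "0 < c" and D: "0 < D" and d: "\<And>k. 0 \<le> d k"
    and descent: "\<And>k. e (Suc k) + c * (d k)\<^sup>2 \<le> e k"
    and lim: "e \<longlonglongrightarrow> \<zeta>"
    and \<eta>: "0 < \<eta>" and \<psi>: "\<And>t. 0 \<le> t \<Longrightarrow> t < \<eta> \<Longrightarrow> 0 \<le> \<psi> t"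
    and mono: "\<And>s t. 0 \<le> t \<Longrightarrow> t \<le> s \<Longrightarrow> s < \<eta> \<Longrightarrow> \<psi> t \<le> \<psi> s"
    and KL: "\<forall>\<^sub>F k in sequentially. \<forall>t. 0 < e (Suc k) - \<zeta> \<and> e (Suc k) - \<zeta> < \<eta> \<and> 0 \<le> t \<and>
      t \<le> e (Suc k) - \<zeta> \<longrightarrow>
      e (Suc k) - \<zeta> - t \<le> (\<psi> (e (Suc k) - \<zeta>) - \<psi> t) * (D * (d (Suc k) + d k))"
  shows "summable d"
proof -
  have "e (Suc k) \<le> e k" for k
    using descent[of k] c by (smt (verit) mult_nonneg_nonneg zero_le_power2)
  then have decr: "decseq e"
    by (rule decseq_SucI)
  then have ge: "\<zeta> \<le> e k" for k
    using lim by (rule decseq_ge)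
  show ?thesis
  \<comment> \<open>If the limit value is attained, descent forces all later steps to be 0. This
    case is separate because the KL inequality speaks only of values strictly above
    \<open>\<zeta>\<close>.\<close>
  proof (cases "\<exists>m. e m = \<zeta>")
    case True
    then obtain m where m: "e m = \<zeta>" by auto
    have "d k = 0" if "m \<le> k" for k
    proof -
      have "e k \<le> \<zeta>"
        using decr that m by (metis decseq_def)
      then have "c * (d k)\<^sup>2 \<le> 0"
        using descent[of k] ge[of "Suc k"] by linarith
      then show ?thesis
        using c by (simp add: mult_le_0_iff)
    qed
    then show ?thesis
      by (intro summable_finite[of "{..<m}"]) (auto simp: not_less)
  next
    case False
    then have gt: "\<zeta> < e k" for k
      using ge[of k] by (metis order_le_less)
    have "\<forall>\<^sub>F k in sequentially. e k < \<zeta> + \<eta>"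
      using order_tendstoD(2)[OF lim] \<eta> by simp
    from eventually_conj[OF this KL] obtain N
      where lt: "\<And>k. N \<le> k \<Longrightarrow> e k < \<zeta> + \<eta>"
        and N: "\<And>k t. N \<le> k \<Longrightarrow> 0 < e (Suc k) - \<zeta> \<Longrightarrow> e (Suc k) - \<zeta> < \<eta> \<Longrightarrow> 0 \<le> t \<Longrightarrow> t \<le> e (Suc k) - \<zeta> \<Longrightarrow>
          e (Suc k) - \<zeta> - t \<le> (\<psi> (e (Suc k) - \<zeta>) - \<psi> t) * (D * (d (Suc k) + d k))"
      unfolding eventually_sequentially by blast
    \<comment> \<open>The factor \<open>D / c\<close> absorbs both constants, so that the squared
      step is bounded without them.\<close>
    define \<Psi> where "\<Psi> k = D / c * \<psi> (e (Suc k) - \<zeta>)" for k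
    have "3/4 * d (Suc k) \<le> \<Psi> k - \<Psi> (Suc k) + d k / 4" if k: "N \<le> k" for k
    proof -
      let ?s = "e (Suc k) - \<zeta>" and ?t = "e (Suc (Suc k)) - \<zeta>"
      let ?a = "\<Psi> k - \<Psi> (Suc k)" and ?b = "d (Suc k) + d k"
      have "c * (d (Suc k))\<^sup>2 \<le> ?s - ?t"
        using descent[of "Suc k"] by simp
      also have "\<dots> \<le> (\<psi> ?s - \<psi> ?t) * (D * ?b)"
        using N[of k ?t] k lt[of "Suc k"] gt[of "Suc k"] gt[of "Suc (Suc k)"] decseqD[OF decr, of "Suc k" "Suc (Suc k)"]
        by simp
      also have "\<dots> = c * (?a * ?b)"
        using c by (simp add: \<Psi>_def field_simps)
      finally have *: "(d (Suc k))\<^sup>2 \<le> ?a * ?b"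
        using c by simp
      \<comment> \<open>AM-GM: \<open>a b \<le> (a + b / 4)\<^sup>2\<close>\<close>
      have "?a * ?b \<le> (?a + ?b / 4)\<^sup>2"
        using zero_le_power2[of "?a - ?b / 4"] by (simp add: power2_eq_square algebra_simps)
      with * have sq: "(d (Suc k))\<^sup>2 \<le> (?a + ?b / 4)\<^sup>2"
        by linarith
      have "\<psi> ?t \<le> \<psi> ?s"
        using mono[of ?t ?s] k lt[of "Suc k"] gt[of "Suc (Suc k)"] decseqD[OF decr, of "Suc k" "Suc (Suc k)"]
        by simp
      then have "0 \<le> ?a"
        using c D by (simp add: \<Psi>_def divide_right_mono mult_left_mono)
      then have "0 \<le> ?a + ?b / 4"
        using d[of k] d[of "Suc k"] by simp
      then have "d (Suc k) \<le> ?a + ?b / 4"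
        using power2_le_imp_le[OF sq] by simp
      then show ?thesis
        by (simp add: field_simps)
    qed
    moreover have "0 \<le> \<Psi> k" if "N \<le> k" for k
      unfolding \<Psi>_def using that c D \<psi>[of "e (Suc k) - \<zeta>"] lt[of "Suc k"] gt[of "Suc k"] by simp
    ultimately show ?thesis
      using d by (intro summable_of_telescoping_bound)
  qed
qed


section \<open>Subgradients of the merit function\<close>

lemma aux_fun_at_subgradient:
  assumes "convex_subgradient f2 z v" "f1 u = ereal a" "f2 z = ereal b"
  shows "aux_fun f1 f2 \<sigma>1 \<gamma> (u, v, z) =
    ereal (a - (u - z) \<bullet> v - b + (\<sigma>1 - \<gamma>) / 2 * (norm (u - z))\<^sup>2)"
  unfolding aux_fun_def
  by (simp add: conjugate_fun_at_subgradient[OF assms(1,3)] assms(2) inner_commute inner_diff_right)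

text \<open>The components come from linearizing \<open>E\<close>: \<open>\<xi>\<close> for
  \<open>f1\<close>, \<open>z\<close> for the conjugate of \<open>f2\<close>, and gradients for the
  smooth terms. The second-order remainder of the smooth terms may be negative but is bounded
  quadratically, so a Frechet subgradient results.\<close>

lemma subdiff_aux_fun:
  fixes f1 f2 :: "'a::euclidean_space \<Rightarrow> ereal"
  assumes f1: "proper_fun f1" and \<xi>: "convex_subgradient f1 u \<xi>" and v: "convex_subgradient f2 z v"
  shows "(\<xi> - v + (\<sigma>1 - \<gamma>) *\<^sub>R (u - z), z - u, - ((\<sigma>1 - \<gamma>) *\<^sub>R (u - z)))
    \<in> subdiff (aux_fun f1 f2 \<sigma>1 \<gamma>) (u, v, z)" (is "?g \<in> subdiff ?E ?p")
proof (intro frechet_subdiff_imp_subdiff frechet_subdiff_quadratic_minorant)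
  define s where "s = \<sigma>1 - \<gamma>"
  obtain a b where ab: "f1 u = ereal a" "f2 z = ereal b"
    using \<xi> v by (auto simp: convex_subgradient_def)
  have Ep: "?E ?p = ereal (a - (u - z) \<bullet> v - b + s / 2 * (norm (u - z))\<^sup>2)"
    unfolding s_def using v ab by (rule aux_fun_at_subgradient)
  show "\<bar>?E ?p\<bar> \<noteq> \<infinity>"
    by (simp add: Ep)
  \<comment> \<open>The 1 dominates the bilinear remainder \<open>U \<bullet> V\<close>;
    \<open>\<bar>s\<bar>\<close> dominates the squared-distance remainder, whose sign is open as
    \<open>s\<close> may be negative.\<close>
  show "0 \<le> 1 + \<bar>s\<bar>"
    by simp
  fix p' :: "'a \<times> 'a \<times> 'a"
  obtain u' v' z' where p': "p' = (u', v', z')"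
    by (cases p')
  define U V Z q where "U = u' - u" "V = v' - v" "Z = z' - z" "q = u - z"
  have eqs: "u' = u + U" "v' = v + V" "z' = z + Z" "u = z + q"
    by (simp_all add: U_V_Z_q_def)
  have f1u': "ereal (a + \<xi> \<bullet> U) \<le> f1 u'"
    using \<xi> by (simp add: convex_subgradient_def ab U_V_Z_q_def)
  \<comment> \<open>Fenchel-Young inequality with \<open>z\<close> fixed: an affine minorant of the
    conjugate that is exact at \<open>v\<close>.\<close>
  have f2v': "ereal (v' \<bullet> z - b) \<le> conjugate_fun f2 v'"
    using ab(2) by (rule conjugate_fun_ge)
  have quad: "- (1 + \<bar>s\<bar>) * ((norm U)\<^sup>2 + (norm V)\<^sup>2 + (norm Z)\<^sup>2) \<le> - (U \<bullet> V) + s / 2 * (norm (U - Z))\<^sup>2"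
  proof -
    have "2 * (U \<bullet> V) \<le> (norm U)\<^sup>2 + (norm V)\<^sup>2"
      using zero_le_power2[of "norm (U - V)"] unfolding power2_norm_eq_inner
      by (simp add: inner_diff inner_commute)
    moreover have "(norm (U - Z))\<^sup>2 \<le> 2 * ((norm U)\<^sup>2 + (norm Z)\<^sup>2)"
      using zero_le_power2[of "norm (U + Z)"] unfolding power2_norm_eq_inner
      by (simp add: inner_diff inner_add inner_commute)
    then have "\<bar>s\<bar> / 2 * (norm (U - Z))\<^sup>2 \<le> \<bar>s\<bar> / 2 * (2 * ((norm U)\<^sup>2 + (norm Z)\<^sup>2))"
      by (intro mult_left_mono) auto
    moreover have "- \<bar>s\<bar> / 2 * (norm (U - Z))\<^sup>2 \<le> s / 2 * (norm (U - Z))\<^sup>2"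
      by (intro mult_right_mono) auto
    moreover have "0 \<le> \<bar>s\<bar> * (norm V)\<^sup>2"
      by simp
    moreover have "- (1 + \<bar>s\<bar>) * ((norm U)\<^sup>2 + (norm V)\<^sup>2 + (norm Z)\<^sup>2) =
        - (norm U)\<^sup>2 - (norm V)\<^sup>2 - (norm Z)\<^sup>2 - \<bar>s\<bar> / 2 * (2 * ((norm U)\<^sup>2 + (norm Z)\<^sup>2)) - \<bar>s\<bar> * (norm V)\<^sup>2"
      by (simp add: algebra_simps)
    ultimately show ?thesis
      using zero_le_power2[of "norm U"] zero_le_power2[of "norm V"] zero_le_power2[of "norm Z"] by linarith
  qed
  have n: "(norm (p' - ?p))\<^sup>2 = (norm U)\<^sup>2 + (norm V)\<^sup>2 + (norm Z)\<^sup>2"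
    by (simp add: p' norm_Pair U_V_Z_q_def)
  have "a - (u - z) \<bullet> v - b + s / 2 * (norm (u - z))\<^sup>2 + (?g \<bullet> (p' - ?p) - (1 + \<bar>s\<bar>) * (norm (p' - ?p))\<^sup>2)
      \<le> (a + \<xi> \<bullet> U) - u' \<bullet> v' + (v' \<bullet> z - b) + s / 2 * (norm (u' - z'))\<^sup>2"
  proof -
    have N: "(norm (u' - z'))\<^sup>2 = (norm q)\<^sup>2 + 2 * (q \<bullet> U) - 2 * (q \<bullet> Z) + (norm (U - Z))\<^sup>2"
      unfolding power2_norm_eq_inner eqs by (simp add: inner_diff inner_add inner_commute)
    have "s / 2 * (norm (u' - z'))\<^sup>2 =
        s / 2 * (norm (u - z))\<^sup>2 + s * (q \<bullet> U) - s * (q \<bullet> Z) + s / 2 * (norm (U - Z))\<^sup>2"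
      unfolding N U_V_Z_q_def(4)[symmetric] by (simp add: algebra_simps)
    moreover have "?g \<bullet> (p' - ?p) = \<xi> \<bullet> U - v \<bullet> U + s * (q \<bullet> U) - q \<bullet> V - s * (q \<bullet> Z)"
      unfolding p' s_def U_V_Z_q_def by (simp add: inner_diff_left inner_add_left)
    moreover have "u' \<bullet> v' = (u - z) \<bullet> v + z \<bullet> v + q \<bullet> V + z \<bullet> V + v \<bullet> U + U \<bullet> V"
      unfolding U_V_Z_q_def by (simp add: inner_diff inner_commute)
    moreover have "v' \<bullet> z = z \<bullet> v + z \<bullet> V"
      unfolding U_V_Z_q_def by (simp add: inner_diff inner_commute)
    ultimately show ?thesis
      using quad unfolding n by linarith
  qed
  then show "?E ?p + ereal (?g \<bullet> (p' - ?p) - (1 + \<bar>s\<bar>) * (norm (p' - ?p))\<^sup>2) \<le> ?E p'"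
    unfolding Ep using f1u' f2v'
    by (cases "f1 u'"; cases "conjugate_fun f2 v'") (auto simp: p' aux_fun_def s_def)
qed

text \<open>The norm of one explicit subgradient bounds the distance. Along the iterates
  \<open>\<xi> - v\<close> is just the inertial term.\<close>

lemma edist_subdiff_aux_fun:
  fixes f1 f2 :: "'a::euclidean_space \<Rightarrow> ereal"
  assumes f1: "proper_fun f1" and \<xi>: "convex_subgradient f1 u \<xi>" and v: "convex_subgradient f2 z v"
  shows "edist_set 0 (subdiff (aux_fun f1 f2 \<sigma>1 \<gamma>) (u, v, z))
    \<le> ereal (norm (\<xi> - v) + (2 * \<bar>\<sigma>1 - \<gamma>\<bar> + 1) * norm (u - z))"
proof -
  let ?s = "\<sigma>1 - \<gamma>"
  let ?g = "(\<xi> - v + ?s *\<^sub>R (u - z), z - u, - (?s *\<^sub>R (u - z)))"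
  have "norm ?g \<le> norm (\<xi> - v + ?s *\<^sub>R (u - z)) + (norm (z - u) + norm (- (?s *\<^sub>R (u - z))))"
    by (intro order_trans[OF norm_Pair_le] add_left_mono norm_Pair_le)
  also have "\<dots> \<le> (norm (\<xi> - v) + \<bar>?s\<bar> * norm (u - z)) + (norm (u - z) + \<bar>?s\<bar> * norm (u - z))"
    by (intro add_mono order_trans[OF norm_triangle_ineq]) (simp_all add: norm_minus_commute)
  also have "\<dots> = norm (\<xi> - v) + (2 * \<bar>?s\<bar> + 1) * norm (u - z)"
    by (simp add: algebra_simps)
  finally have "norm (0 - ?g) \<le> norm (\<xi> - v) + (2 * \<bar>?s\<bar> + 1) * norm (u - z)"
    by (simp only: diff_0 norm_minus_cancel)
  then show ?thesis
    unfolding edist_set_def using subdiff_aux_fun[OF assms]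
    by (intro INF_lower2[of ?g]) (simp_all only: ereal_less_eq)
qed


section \<open>The inertial DC algorithm\<close>

locale inertial_dca =
  fixes f1 f2 :: "'a::euclidean_space \<Rightarrow> ereal"
    and \<sigma>1 \<sigma>2 \<gamma> fstar :: real and Y :: "'a set" and x y :: "nat \<Rightarrow> 'a"
  assumes f1: "proper_fun f1" "closed_fun f1" "convex_fun f1" "sigma_convex \<sigma>1 f1"
    and f2: "proper_fun f2" "convex_fun f2" "sigma_convex \<sigma>2 f2"
    and \<sigma>: "0 < \<sigma>1 + \<sigma>2"
    and Y: "closed Y" "edom f1 \<subseteq> Y" "Y \<subseteq> interior (edom f2)"
    and below: "\<And>u. ereal fstar \<le> dc_fun f1 f2 u"
    and \<gamma>: "0 \<le> \<gamma>" "\<gamma> < (\<sigma>1 + \<sigma>2) / 2"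
    and iter: "RInDCA_e f1 f2 \<gamma> x y"
begin

definition w where "w k = y k + \<gamma> *\<^sub>R (x k - prev x k)"
definition \<delta> where "\<delta> k = x (Suc k) - x k"
definition a where "a k = real_of_ereal (f1 (x k))"
definition b where "b k = real_of_ereal (f2 (x k))"
definition p where "p k = (x (Suc k), y k, x k)"
text \<open>The real value of \<open>E (p k)\<close>, with the conjugate at \<open>y k\<close>
  eliminated by Fenchel equality.\<close>

definition e where
  "e k = a (Suc k) - \<delta> k \<bullet> y k - b k + (\<sigma>1 - \<gamma>) / 2 * (norm (\<delta> k))\<^sup>2"

abbreviation "E \<equiv> aux_fun f1 f2 \<sigma>1 \<gamma>"

section \<open>Optimality conditions and finiteness along the iterates\<close>

lemma subgradient_f2: "convex_subgradient f2 (x k) (y k)"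
  using iter f2 by (simp add: RInDCA_e_def subdiff_iff_convex_subgradient)

lemma subgradient_f1: "convex_subgradient f1 (x (Suc k)) (w k)"
proof -
  have min: "\<not> f1 u - ereal (w k \<bullet> u) < f1 (x (Suc k)) - ereal (w k \<bullet> x (Suc k))" for u
    using iter by (simp add: RInDCA_e_def is_arg_min_def w_def)
  have notMInf: "f1 u \<noteq> - \<infinity>" for u
    using f1 by (simp add: proper_fun_def)
  obtain u0 where "f1 u0 < \<infinity>"
    using f1 by (auto simp: proper_fun_def edom_def)
  then have fin: "\<bar>f1 (x (Suc k))\<bar> \<noteq> \<infinity>"
    using min[of u0] notMInf[of "x (Suc k)"] notMInf[of u0]
    by (cases "f1 u0"; cases "f1 (x (Suc k))") auto
  have "f1 (x (Suc k)) + ereal (w k \<bullet> (u - x (Suc k))) \<le> f1 u" for u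
    using min[of u] fin notMInf[of u]
    by (cases "f1 u"; cases "f1 (x (Suc k))") (auto simp: inner_diff_right)
  with fin show ?thesis
    by (simp add: convex_subgradient_def)
qed

lemma f1_x: "f1 (x k) = ereal (a k)"
proof (cases k)
  case 0
  have "f1 (x 0) < \<infinity>" "f1 (x 0) \<noteq> - \<infinity>"
    using iter f1 by (auto simp: RInDCA_e_def edom_def proper_fun_def)
  then show ?thesis
    unfolding a_def 0 by (cases "f1 (x 0)") auto
next
  case (Suc j)
  then show ?thesis
    using subgradient_f1[of j] by (simp add: convex_subgradient_def a_def ereal_real)
qed

lemma f2_x: "f2 (x k) = ereal (b k)"
  using subgradient_f2[of k] by (simp add: convex_subgradient_def b_def ereal_real)

lemma x_in_Y: "x k \<in> Y"
  using f1_x[of k] Y(2) by (auto simp: edom_def)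

lemma E_p: "E (p k) = ereal (e k)"
  unfolding p_def e_def \<delta>_def using subgradient_f2 f1_x f2_x by (rule aux_fun_at_subgradient)

section \<open>Descent of the merit values\<close>

lemma f2_step: "b k + y k \<bullet> \<delta> k + \<sigma>2 / 2 * (norm (\<delta> k))\<^sup>2 \<le> b (Suc k)"
  using convex_subgradient_strong[OF f2(3) subgradient_f2 f2_x f2_x, of k "Suc k"]
  by (simp add: \<delta>_def)

text \<open>The strong subgradient inequalities are applied to \<open>f1\<close> at
  \<open>x (Suc (Suc k))\<close> and to \<open>f2\<close> at \<open>x k\<close>, both tested at
  \<open>x (Suc k)\<close>. Young's inequality halves the inertial cross term: one half is absorbed
  by the reduced weight \<open>\<sigma>1 - \<gamma>\<close> in \<open>E\<close>, and what remains of
  the gain is \<open>(\<sigma>1 + \<sigma>2) / 2 - \<gamma>\<close>.\<close>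

lemma descent: "e (Suc k) + ((\<sigma>1 + \<sigma>2) / 2 - \<gamma>) * (norm (\<delta> k))\<^sup>2 \<le> e k"
proof -
  let ?d = "\<delta> k" and ?d' = "\<delta> (Suc k)"
  have "a (Suc (Suc k)) + w (Suc k) \<bullet> (x (Suc k) - x (Suc (Suc k)))
      + \<sigma>1 / 2 * (norm (x (Suc k) - x (Suc (Suc k))))\<^sup>2 \<le> a (Suc k)"
    using convex_subgradient_strong[OF f1(4) subgradient_f1 f1_x f1_x] by blast
  moreover have "x (Suc k) - x (Suc (Suc k)) = - ?d'"
    by (simp add: \<delta>_def)
  moreover have "w (Suc k) = y (Suc k) + \<gamma> *\<^sub>R ?d"
    by (simp add: w_def \<delta>_def prev_def)
  ultimately have 1: "a (Suc (Suc k)) - ?d' \<bullet> y (Suc k) - \<gamma> * (?d \<bullet> ?d') + \<sigma>1 / 2 * (norm ?d')\<^sup>2 \<le> a (Suc k)"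
    by (simp add: inner_add inner_commute)
  have "2 * (?d \<bullet> ?d') \<le> (norm ?d)\<^sup>2 + (norm ?d')\<^sup>2"
    using zero_le_power2[of "norm (?d - ?d')"] unfolding power2_norm_eq_inner
    by (simp add: inner_diff inner_commute)
  then have 2: "\<gamma> / 2 * (2 * (?d \<bullet> ?d')) \<le> \<gamma> / 2 * ((norm ?d)\<^sup>2 + (norm ?d')\<^sup>2)"
    using \<gamma>(1) by (intro mult_left_mono) auto
  show ?thesis
    using 1 2 f2_step[of k] unfolding e_def
    by (simp add: algebra_simps add_divide_distrib diff_divide_distrib inner_commute)
qed

text \<open>By \<open>f2_step\<close>, \<open>e k\<close> exceeds the objective value at
  \<open>x (Suc k)\<close> by at least a nonnegative multiple of the squared step.\<close>

lemma e_ge: "fstar \<le> e k"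
proof -
  have "fstar \<le> a (Suc k) - b (Suc k)"
    using below[of "x (Suc k)"] by (simp add: dc_fun_def edom_def f1_x f2_x)
  moreover have "0 \<le> (\<sigma>1 + \<sigma>2 - \<gamma>) / 2 * (norm (\<delta> k))\<^sup>2"
    using \<gamma> \<sigma> by (intro mult_nonneg_nonneg) auto
  ultimately show ?thesis
    using f2_step[of k] unfolding e_def
    by (simp add: algebra_simps add_divide_distrib diff_divide_distrib inner_commute)
qed

lemma e_convergent: "convergent e"
proof -
  have "e (Suc k) \<le> e k" for k
    using descent[of k] \<gamma>(2) by (smt (verit) mult_nonneg_nonneg zero_le_power2)
  then have "decseq e"
    by (rule decseq_SucI)
  then show ?thesis
    using e_ge decseq_convergent[of e fstar] by (metis convergentI)
qed

lemma \<delta>_tendsto: "\<delta> \<longlonglongrightarrow> 0"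
proof -
  let ?c = "(\<sigma>1 + \<sigma>2) / 2 - \<gamma>"
  obtain \<zeta> where \<zeta>: "e \<longlonglongrightarrow> \<zeta>"
    using e_convergent by (auto simp: convergent_def)
  have "(\<lambda>k. (e k - e (Suc k)) / ?c) \<longlonglongrightarrow> (\<zeta> - \<zeta>) / ?c"
    using \<gamma>(2) by (intro tendsto_divide tendsto_diff \<zeta> LIMSEQ_Suc[OF \<zeta>] tendsto_const) auto
  then have lim: "(\<lambda>k. (e k - e (Suc k)) / ?c) \<longlonglongrightarrow> 0"
    by simp
  have le: "(norm (\<delta> k))\<^sup>2 \<le> (e k - e (Suc k)) / ?c" for k
    using descent[of k] \<gamma>(2) by (simp add: pos_le_divide_eq mult.commute)
  have "(\<lambda>k. (norm (\<delta> k))\<^sup>2) \<longlonglongrightarrow> 0"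
    by (rule tendsto_sandwich[OF _ _ tendsto_const lim]) (use le in auto)
  from tendsto_real_sqrt[OF this] show ?thesis
    by (simp add: tendsto_norm_zero_iff)
qed

lemma prev_tendsto: "(\<lambda>k. x k - prev x k) \<longlonglongrightarrow> 0"
  using \<delta>_tendsto by (subst filterlim_sequentially_Suc[symmetric]) (simp add: prev_def \<delta>_def[abs_def])

section \<open>Stationarity error and cluster points\<close>

lemma edist_subdiff_E:
  "edist_set 0 (subdiff E (p k)) \<le>
    ereal ((\<gamma> + 2 * \<bar>\<sigma>1 - \<gamma>\<bar> + 1) * (norm (\<delta> k) + norm (x k - prev x k)))"
proof -
  have "edist_set 0 (subdiff E (p k)) \<le>
      ereal (norm (w k - y k) + (2 * \<bar>\<sigma>1 - \<gamma>\<bar> + 1) * norm (x (Suc k) - x k))"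
    unfolding p_def using f1(1) subgradient_f1 subgradient_f2 by (rule edist_subdiff_aux_fun)
  also have "norm (w k - y k) = \<gamma> * norm (x k - prev x k)"
    using \<gamma>(1) by (simp add: w_def)
  also have "\<gamma> * norm (x k - prev x k) + (2 * \<bar>\<sigma>1 - \<gamma>\<bar> + 1) * norm (x (Suc k) - x k) \<le>
      (\<gamma> + 2 * \<bar>\<sigma>1 - \<gamma>\<bar> + 1) * norm (x k - prev x k) + (\<gamma> + 2 * \<bar>\<sigma>1 - \<gamma>\<bar> + 1) * norm (x (Suc k) - x k)"
    using \<gamma>(1) by (intro add_mono mult_right_mono) auto
  finally show ?thesis
    by (simp add: \<delta>_def algebra_simps)
qed

text \<open>\<open>f2\<close> is continuous at \<open>u\<close>, but \<open>f1\<close> is only lower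
  semicontinuous. The limit of \<open>f1\<close> along the iterates is therefore read off from that
  of \<open>e\<close> and identified with \<open>f1 u\<close> by two inequalities.\<close>

lemma cluster_point:
  assumes r: "strict_mono (r::nat \<Rightarrow> nat)" and xr: "(x \<circ> r) \<longlonglongrightarrow> u" and yr: "(y \<circ> r) \<longlonglongrightarrow> v"
    and \<zeta>: "e \<longlonglongrightarrow> \<zeta>"
  shows "convex_subgradient f1 u v" "convex_subgradient f2 u v" "E (u, v, u) = ereal \<zeta>"
proof -
  have x: "(\<lambda>n. x (r n)) \<longlonglongrightarrow> u" and y: "(\<lambda>n. y (r n)) \<longlonglongrightarrow> v" and e: "(\<lambda>n. e (r n)) \<longlonglongrightarrow> \<zeta>"
    and \<delta>: "(\<lambda>n. \<delta> (r n)) \<longlonglongrightarrow> 0" and pr: "(\<lambda>n. x (r n) - prev x (r n)) \<longlonglongrightarrow> 0"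
    using xr yr LIMSEQ_subseq_LIMSEQ[OF \<zeta> r] LIMSEQ_subseq_LIMSEQ[OF \<delta>_tendsto r]
      LIMSEQ_subseq_LIMSEQ[OF prev_tendsto r] by (simp_all add: o_def)
  have "(\<lambda>n. x (r n) + \<delta> (r n)) \<longlonglongrightarrow> u + 0"
    using x \<delta> by (rule tendsto_add)
  then have xS: "(\<lambda>n. x (Suc (r n))) \<longlonglongrightarrow> u"
    by (simp add: \<delta>_def)
  have "(\<lambda>n. y (r n) + \<gamma> *\<^sub>R (x (r n) - prev x (r n))) \<longlonglongrightarrow> v + \<gamma> *\<^sub>R 0"
    by (intro tendsto_intros y pr)
  then have w: "(\<lambda>n. w (r n)) \<longlonglongrightarrow> v"
    by (simp add: w_def)
  have "u \<in> Y"
    using Y(1) x_in_Y x closed_sequentially[of Y "\<lambda>n. x (r n)" u] by blast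
  then have u: "u \<in> interior (edom f2)"
    using Y(3) by blast
  then have "u \<in> edom f2"
    using interior_subset by blast
  then obtain \<beta> where \<beta>: "f2 u = ereal \<beta>"
    using f2(1) by (cases "f2 u") (auto simp: edom_def proper_fun_def)
  have "isCont (\<lambda>u. real_of_ereal (f2 u)) u"
    using continuous_on_real_of_convex_fun[OF f2(1,2)] u
    by (simp add: continuous_on_eq_continuous_at)
  from isCont_tendsto_compose[OF this x] have b: "(\<lambda>n. b (r n)) \<longlonglongrightarrow> \<beta>"
    by (simp add: \<beta> f2_x)
  then have f2lim: "(\<lambda>n. f2 (x (r n))) \<longlonglongrightarrow> f2 u"
    by (simp add: \<beta> f2_x)
  show sub2: "convex_subgradient f2 u v"
    using convex_subgradient_limit[of f2 "\<lambda>n. x (r n)" "\<lambda>n. y (r n)", OF subgradient_f2 x y f2lim]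
    by (simp add: \<beta>)
  \<comment> \<open>The limit forced on \<open>a\<close>, as the step terms in \<open>e\<close>
    vanish and \<open>b\<close> tends to \<open>\<beta>\<close>.\<close>
  define \<alpha> where "\<alpha> = \<zeta> + \<beta>"
  have "(\<lambda>n. e (r n) + \<delta> (r n) \<bullet> y (r n) + b (r n) - (\<sigma>1 - \<gamma>) / 2 * (norm (\<delta> (r n)))\<^sup>2) \<longlonglongrightarrow>
      \<zeta> + 0 \<bullet> v + \<beta> - (\<sigma>1 - \<gamma>) / 2 * (norm (0::'a))\<^sup>2"
    by (intro tendsto_intros e \<delta> y b)
  then have a: "(\<lambda>n. a (Suc (r n))) \<longlonglongrightarrow> \<alpha>"
    by (simp add: e_def \<alpha>_def)
  have "(u, \<alpha>) \<in> epigraph_ereal f1"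
  proof (rule closed_sequentially)
    show "closed (epigraph_ereal f1)"
      using f1(2) by (simp add: closed_fun_def)
    show "(\<lambda>n. (x (Suc (r n)), a (Suc (r n)))) \<longlonglongrightarrow> (u, \<alpha>)"
      using xS a by (rule tendsto_Pair)
  qed (simp add: epigraph_ereal_def f1_x)
  then have "f1 u \<le> ereal \<alpha>"
    by (simp add: epigraph_ereal_def)
  \<comment> \<open>The reverse inequality: the affine minorants given by the subgradients
    \<open>w\<close>, evaluated at \<open>u\<close>, tend to \<open>\<alpha>\<close>.\<close>
  moreover have "ereal \<alpha> \<le> f1 u"
  proof (rule LIMSEQ_le_const2)
    have "(\<lambda>n. ereal (a (Suc (r n)) + w (r n) \<bullet> (u - x (Suc (r n))))) \<longlonglongrightarrow> ereal (\<alpha> + v \<bullet> (u - u))"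
      by (intro tendsto_intros a w xS)
    then show "(\<lambda>n. ereal (a (Suc (r n)) + w (r n) \<bullet> (u - x (Suc (r n))))) \<longlonglongrightarrow> ereal \<alpha>"
      by simp
    show "\<exists>N. \<forall>n\<ge>N. ereal (a (Suc (r n)) + w (r n) \<bullet> (u - x (Suc (r n)))) \<le> f1 u"
      using subgradient_f1 by (auto simp: convex_subgradient_def f1_x)
  qed
  ultimately have \<alpha>: "f1 u = ereal \<alpha>"
    by (rule antisym)
  have f1lim: "(\<lambda>n. f1 (x (Suc (r n)))) \<longlonglongrightarrow> f1 u"
    using a by (simp add: \<alpha> f1_x)
  show "convex_subgradient f1 u v"
    using convex_subgradient_limit[of f1 "\<lambda>n. x (Suc (r n))" "\<lambda>n. w (r n)", OF subgradient_f1 xS w f1lim]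
    by (simp add: \<alpha>)
  show "E (u, v, u) = ereal \<zeta>"
    using aux_fun_at_subgradient[of f2 u v f1 u \<alpha> \<beta> \<sigma>1 \<gamma>, OF sub2 \<alpha> \<beta>] by (simp add: \<alpha>_def)
qed

section \<open>Convergence of the whole sequence\<close>

lemma bounded_y:
  assumes "bounded (range x)"
  shows "bounded (range y)"
proof -
  have "closure (range x) \<subseteq> Y"
    using x_in_Y Y(1) by (intro closure_minimal) auto
  then have "bounded {v. \<exists>u\<in>closure (range x). convex_subgradient f2 u v}"
    using assms Y(3) by (intro bounded_convex_subgradients f2) (auto simp: compact_closure)
  then show ?thesis
    by (rule bounded_subset) (use subgradient_f2 closure_subset[of "range x"] in auto)
qed

lemma convergent_to_critical_point:
  assumes KL: "KL_function E" and bdd: "bounded (range x)"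
  shows "\<exists>xbar. x \<longlonglongrightarrow> xbar \<and> critical_point f1 f2 xbar"
proof -
  obtain \<zeta> where \<zeta>: "e \<longlonglongrightarrow> \<zeta>"
    using e_convergent by (auto simp: convergent_def)
  have "bounded (range p)"
    using bounded_Times[OF bdd bounded_Times[OF bounded_y[OF bdd] bdd]]
    by (rule bounded_subset) (auto simp: p_def)
  moreover have "E q = ereal \<zeta> \<and> KL_property_at E q"
    if r: "strict_mono (r::nat \<Rightarrow> nat)" and pr: "(p \<circ> r) \<longlonglongrightarrow> q" for q r
  proof -
    obtain u v z where q: "q = (u, v, z)"
      by (cases q)
    have lims: "(\<lambda>n. x (Suc (r n))) \<longlonglongrightarrow> u" "(\<lambda>n. y (r n)) \<longlonglongrightarrow> v" "(\<lambda>n. x (r n)) \<longlonglongrightarrow> z"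
      using tendsto_fst[OF pr] tendsto_fst[OF tendsto_snd[OF pr]] tendsto_snd[OF tendsto_snd[OF pr]]
      by (simp_all add: q p_def o_def)
    \<comment> \<open>Since the steps tend to 0, cluster points of \<open>p\<close> have equal first
      and third components.\<close>
    have "(\<lambda>n. \<delta> (r n)) \<longlonglongrightarrow> u - z"
      unfolding \<delta>_def by (intro tendsto_diff lims)
    then have "u = z"
      using LIMSEQ_unique[OF LIMSEQ_subseq_LIMSEQ[OF \<delta>_tendsto r]] by (fastforce simp: o_def)
    have *: "convex_subgradient f1 u v" "convex_subgradient f2 u v" "E (u, v, u) = ereal \<zeta>"
      using cluster_point[OF r _ _ \<zeta>, of u v] lims \<open>u = z\<close> by (simp_all add: o_def)
    have "subdiff E (u, v, u) \<noteq> {}"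
      using subdiff_aux_fun[OF f1(1) *(1,2), of \<sigma>1 \<gamma>] by auto
    then show ?thesis
      using KL * \<open>u = z\<close> by (simp add: q KL_function_def dom_subdiff_def)
  qed
  ultimately obtain \<eta> U \<psi> where \<eta>: "0 < \<eta>" and sur: "integrated_KL E \<zeta> \<eta> \<psi> U"
    and ev: "\<forall>\<^sub>F k in sequentially. p k \<in> U"
    using integrated_KL_along_bounded_sequence[of p E \<zeta>] by blast
  let ?D = "\<gamma> + 2 * \<bar>\<sigma>1 - \<gamma>\<bar> + 1"
  have "summable (\<lambda>k. norm (\<delta> k))"
  proof (rule summable_of_KL_descent[OF _ _ _ descent \<zeta> \<eta>])
    show "0 < (\<sigma>1 + \<sigma>2) / 2 - \<gamma>"
      using \<gamma>(2) by simp
    show "0 < ?D"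
      using \<gamma>(1) by (intro add_nonneg_pos) auto
    show "0 \<le> \<psi> t" if "0 \<le> t" "t < \<eta>" for t
      using sur that by (simp add: integrated_KL_def)
    show "\<psi> t \<le> \<psi> s" if "0 \<le> t" "t \<le> s" "s < \<eta>" for s t
      using sur that by (simp add: integrated_KL_def)
    \<comment> \<open>Shifted by one so that \<open>prev\<close> refers to a genuine predecessor and
      the distance bound involves \<open>\<delta> k\<close>.\<close>
    have "\<forall>\<^sub>F k in sequentially. p (Suc k) \<in> U"
      using ev by (subst eventually_sequentially_Suc)
    then show "\<forall>\<^sub>F k in sequentially. \<forall>t. 0 < e (Suc k) - \<zeta> \<and> e (Suc k) - \<zeta> < \<eta> \<and> 0 \<le> t \<and>
        t \<le> e (Suc k) - \<zeta> \<longrightarrow>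
        e (Suc k) - \<zeta> - t \<le> (\<psi> (e (Suc k) - \<zeta>) - \<psi> t) * (?D * (norm (\<delta> (Suc k)) + norm (\<delta> k)))"
    proof (rule eventually_mono, intro allI impI)
      fix k t
      assume U: "p (Suc k) \<in> U" and t: "0 < e (Suc k) - \<zeta> \<and> e (Suc k) - \<zeta> < \<eta> \<and> 0 \<le> t \<and> t \<le> e (Suc k) - \<zeta>"
      have "E (p (Suc k)) = ereal (\<zeta> + (e (Suc k) - \<zeta>))"
        by (simp add: E_p)
      moreover have "edist_set 0 (subdiff E (p (Suc k))) \<le> ereal (?D * (norm (\<delta> (Suc k)) + norm (\<delta> k)))"
        using edist_subdiff_E[of "Suc k"] by (simp add: prev_def \<delta>_def)
      ultimately show "e (Suc k) - \<zeta> - t \<le> (\<psi> (e (Suc k) - \<zeta>) - \<psi> t) * (?D * (norm (\<delta> (Suc k)) + norm (\<delta> k)))"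
        using sur[unfolded integrated_KL_def, THEN conjunct2, THEN conjunct2, rule_format, OF U] t by blast
    qed
  qed auto
  then have "summable \<delta>"
    by (rule summable_norm_cancel)
  then have "(\<lambda>n. x 0 + (\<Sum>k<n. \<delta> k)) \<longlonglongrightarrow> x 0 + suminf \<delta>"
    by (intro tendsto_intros summable_LIMSEQ)
  moreover have "x 0 + (\<Sum>k<n. \<delta> k) = x n" for n
    using sum_lessThan_telescope[of x n] by (simp add: \<delta>_def)
  ultimately obtain xbar where xbar: "x \<longlonglongrightarrow> xbar"
    by auto
  \<comment> \<open>\<open>y\<close> need not converge; one of its cluster points supplies a common
    subgradient at \<open>xbar\<close>.\<close>
  obtain v r where r: "strict_mono (r::nat \<Rightarrow> nat)" "(y \<circ> r) \<longlonglongrightarrow> v"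
    using bounded_imp_convergent_subsequence[OF bounded_y[OF bdd]] by blast
  have "v \<in> subdiff f1 xbar \<inter> subdiff f2 xbar"
    using cluster_point(1,2)[OF r(1) LIMSEQ_subseq_LIMSEQ[OF xbar r(1)] r(2) \<zeta>]
    by (auto intro: convex_subgradient_imp_subdiff)
  then show ?thesis
    using xbar by (auto simp: critical_point_def)
qed

end

theorem theorem3:
  fixes f1 f2 :: "real ^ 'n \<Rightarrow> ereal"
    and \<sigma>1 \<sigma>2 \<gamma> fstar :: real
    and Y :: "(real ^ 'n) set"
    and x y :: "nat \<Rightarrow> real ^ 'n"
  defines "E \<equiv> aux_fun f1 f2 \<sigma>1 \<gamma>"
  assumes "proper_fun f1" "closed_fun f1" "convex_fun f1"
    and "proper_fun f2" "closed_fun f2" "convex_fun f2"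
    and "0 \<le> \<sigma>1" "0 \<le> \<sigma>2" "0 < \<sigma>1 + \<sigma>2"
    and "sigma_convex \<sigma>1 f1" "sigma_convex \<sigma>2 f2"
    and "closed Y" "edom f1 \<subseteq> Y" "Y \<subseteq> interior (edom f2)"
    and "\<And>u. ereal fstar \<le> dc_fun f1 f2 u"
    and "0 \<le> \<gamma>" "\<gamma> < (\<sigma>1 + \<sigma>2) / 2"
    and "RInDCA_e f1 f2 \<gamma> x y"
    and "KL_function E"
  shows "(\<exists>D>0. \<forall>k\<ge>1. edist_set 0 (subdiff E (x k, y (k - 1), x (k - 1)))
             \<le> ereal (D * (norm (x k - x (k - 1)) + norm (x (k - 1) - prev x (k - 1)))))
       \<and> (bounded (range x) \<longrightarrow>
            (\<exists>xbar. x \<longlonglongrightarrow> xbar \<and> critical_point f1 f2 xbar))"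
proof -
  interpret inertial_dca f1 f2 \<sigma>1 \<sigma>2 \<gamma> fstar Y x y
    using assms(2-) by unfold_locales
  let ?D = "\<gamma> + 2 * \<bar>\<sigma>1 - \<gamma>\<bar> + 1"
  \<comment> \<open>The index \<open>k - 1\<close> matches the pairing in \<open>p\<close>; at
    \<open>k = 1\<close> the term with \<open>prev\<close> is 0 by the convention for the iterate
    before the start.\<close>
  have "edist_set 0 (subdiff E (x k, y (k - 1), x (k - 1)))
      \<le> ereal (?D * (norm (x k - x (k - 1)) + norm (x (k - 1) - prev x (k - 1))))" if "1 \<le> k" for k
    using edist_subdiff_E[of "k - 1"] that by (simp add: E_def p_def \<delta>_def)
  moreover have "0 < ?D"
    using \<open>0 \<le> \<gamma>\<close> by (intro add_nonneg_pos) auto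
  ultimately show ?thesis
    using convergent_to_critical_point \<open>KL_function E\<close> unfolding E_def by blast
qed


end
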